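(* For all $(p,q)\in\mathbf{N}$, the following equality in distribution holds: $$\Lambda^*_{p,q} \stackrel{d}{=} 3+2\left( \cos \mathcal{U} + \cos \left( \frac{p\, \mathcal{U} + 2\pi \mathcal{J}_{p,q}}{p+q} \right) + \cos \left(\frac{q\, \mathcal{U} - 2\pi \mathcal{J}_{p,q}}{p+q} \right) \right),$$ where $\mathcal{U}$ is uniformly distributed on $(0,\pi)$, $\mathcal{J}_{p,q}$ is uniformly distributed on $\{0,\ldots,p+q-1\}$, and $\mathcal{U}$ and $\mathcal{J}_{p,q}$ are independent.
   Context: $\mathbb{N}_0=\{0,1,2,\ldots\}$ and $\mathbf{N}:=\{(p,q)\in\mathbb{N}_0^2 : p+q\ge 5,\ q\le p\}$. For such $(p,q)$, $\Lambda^*_{p,q}$ denotes the random eigenvalue of the dual infinite $(p,q)$-nanotube (the triangular lattice with a loop of weight $3$ at each vertex, rolled up along the chiral vector $(p,q)$), i.e. the real random variable with compactly supported distribution whose moments $\mu_k(\Lambda^*_{p,q})=\mathbb{E}(\Lambda^*_{p,q})^k$, $k\in\mathbb{N}_0$, are the (weighted) numbers of closed paths with $k$ steps from a vertex of this graph, given by $$\mu_k(\Lambda^*_{p,q})=\frac{1}{(2\pi)^3}\sum_{j\in\mathbb{Z}}\int_{-\pi}^{\pi}\int_{-\pi}^{\pi}\int_{-\pi}^{\pi}\left|e^{ix}+e^{iy}+e^{iz}\right|^{2k}e^{ij(p(x-z)+q(y-z))}\,dx\,dy\,dz .$$ For each fixed $k$ only finitely many terms of the sum are non-zero, and these moments determine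 the (compactly supported) distribution of $\Lambda^*_{p,q}$ uniquely. The symbol $\stackrel{d}{=}$ denotes equality in distribution. *)

theory Defs
  imports "HOL-Probability.Probability"
begin

text \<open>
  The (weighted) number of closed paths with \<open>k\<close> steps from a vertex of the dual infinite
  \<open>(p, q)\<close>-nanotube. Only finitely many summands are non-zero, so the infinite sum is
  summable whenever \<open>p + q > 0\<close>. The value is real, but the formula is complex as it stands.
\<close>
definition dual_nanotube_moment :: "nat \<Rightarrow> nat \<Rightarrow> nat \<Rightarrow> complex" where
  "dual_nanotube_moment p q k =
     complex_of_real (1 / (2 * pi) ^ 3) *
     (\<Sum>\<^sub>\<infinity>j::int.
        (LBINT x:{-pi..pi}. (LBINT y:{-pi..pi}. (LBINT z:{-pi..pi}.
           complex_of_real (cmod (exp (\<i> * complex_of_real x) + exp (\<i> * complex_of_real y)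
                                  + exp (\<i> * complex_of_real z)) ^ (2 * k)) *
           exp (\<i> * of_int j *
                complex_of_real (real p * (x - z) + real q * (y - z)))))))"

definition has_dual_nanotube_moments :: "nat \<Rightarrow> nat \<Rightarrow> real measure \<Rightarrow> bool" where
  "has_dual_nanotube_moments p q \<mu> \<longleftrightarrow>
     prob_space \<mu> \<and> sets \<mu> = sets borel \<and>
     (\<exists>K. compact K \<and> (AE x in \<mu>. x \<in> K)) \<and>
     (\<forall>k. complex_of_real (\<integral>x. x ^ k \<partial>\<mu>) = dual_nanotube_moment p q k)"

text \<open>
  The distribution of the random eigenvalue \<open>\<Lambda>\<^sup>*\<close> of the dual infinite \<open>(p, q)\<close>-nanotube.
  A compactly supported distribution is determined by its moments, so at most one measure
  satisfies the description.
\<close>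
definition dual_nanotube_eigenvalue_law :: "nat \<Rightarrow> nat \<Rightarrow> real measure" where
  "dual_nanotube_eigenvalue_law p q = (THE \<mu>. has_dual_nanotube_moments p q \<mu>)"

end

theory Submission
  imports Defs
begin

text \<open>
  Expanding $|e^{ix} + e^{iy} + e^{iz}|^{2k}$ into exponentials
  $e^{i(\alpha x + \beta y - (\alpha + \beta) z)}$, the triple integral against
  $e^{ij(p(x - z) + q(y - z))}$ selects those with $(\alpha, \beta) = -j(p, q)$, so the moment counts
  the exponents on the line $\mathbb{Z}(p, q)$. The pairs
  $a = (qU - 2\pi J)/(p+q)$, $b = -(pU + 2\pi J)/(p+q)$ run through the subgroup $pa + qb \in 2\pi\mathbb{Z}$
  of the torus, whose annihilator is that line: averaging over $J$ forces $p + q$ to divide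
  $\alpha + \beta$, and averaging over $U$ then forces $(\alpha, \beta) \in \mathbb{Z}(p, q)$.
  The moments are therefore equal, and they determine a compactly supported law through the power
  series of its characteristic function.
\<close>

section \<open>Determinacy of compactly supported laws by their moments\<close>

text \<open>By \<open>char_approx1\<close>, the Taylor polynomial of degree n misses the
  characteristic function by at most twice |t|^n / n! times the n-th absolute moment. Boundedness by
  R turns this into a term of the exponential series of |t| R, which tends to 0 for every t, so the
  power series converges on the whole line.\<close>

lemma char_sums_moments:
  assumes "real_distribution \<mu>" and ae: "AE x in \<mu>. \<bar>x\<bar> \<le> R"
  shows "(\<lambda>k. (\<i> * complex_of_real t) ^ k / fact k * complex_of_real (\<integral>x. x ^ k \<partial>\<mu>)) sums char \<mu> t"
proof -
  interpret real_distribution \<mu> by fact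
  have int: "integrable \<mu> (\<lambda>x. \<bar>x\<bar> ^ k)" "integrable \<mu> (\<lambda>x. x ^ k)" for k
  proof -
    have "AE x in \<mu>. \<bar>x\<bar> ^ k \<le> R ^ k"
      using ae by eventually_elim (simp add: power_mono)
    then show "integrable \<mu> (\<lambda>x. \<bar>x\<bar> ^ k)" "integrable \<mu> (\<lambda>x. x ^ k)"
      by (auto intro!: integrable_const_bound[where B = "R ^ k"] simp: power_abs)
  qed
  have mom: "expectation (\<lambda>x. \<bar>x\<bar> ^ k) \<le> R ^ k" for k
  proof -
    have "AE x in \<mu>. \<bar>x\<bar> ^ k \<le> R ^ k"
      using ae by eventually_elim (simp add: power_mono)
    then show ?thesis
      using integral_mono_AE[OF int(1)[of k], of "\<lambda>_. R ^ k"] prob_space by simp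
  qed
  have bound: "cmod (char \<mu> t - (\<Sum>k\<le>n. (\<i> * complex_of_real t) ^ k / fact k
      * complex_of_real (\<integral>x. x ^ k \<partial>\<mu>))) \<le> 2 * ((\<bar>t\<bar> * R) ^ n / fact n)" for n
  proof -
    have "(2 * \<bar>t\<bar> ^ n / fact n) * expectation (\<lambda>x. \<bar>x\<bar> ^ n) \<le> (2 * \<bar>t\<bar> ^ n / fact n) * R ^ n"
      by (intro mult_left_mono mom) simp
    then show ?thesis
      using char_approx1[of n t, OF int(2)] by (simp add: power_mult_distrib)
  qed
  have lim: "(\<lambda>n. 2 * ((\<bar>t\<bar> * R) ^ n / fact n)) \<longlonglongrightarrow> 0"
    using tendsto_mult_left[OF summable_LIMSEQ_zero[OF summable_exp[of "\<bar>t\<bar> * R"]], of 2]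
    by (simp add: field_simps)
  have "(\<lambda>n. (\<Sum>k\<le>n. (\<i> * complex_of_real t) ^ k / fact k
      * complex_of_real (\<integral>x. x ^ k \<partial>\<mu>))) \<longlonglongrightarrow> char \<mu> t"
    unfolding tendsto_iff dist_norm
  proof (intro allI impI)
    fix e :: real assume "e > 0"
    with lim have "eventually (\<lambda>n. 2 * ((\<bar>t\<bar> * R) ^ n / fact n) < e) sequentially"
      by (rule order_tendstoD)
    then show "\<forall>\<^sub>F n in sequentially. cmod ((\<Sum>k\<le>n. (\<i> * complex_of_real t) ^ k / fact k
      * complex_of_real (\<integral>x. x ^ k \<partial>\<mu>)) - char \<mu> t) < e"
    proof eventually_elim
      case (elim n)
      then show ?case using bound[of n] by (simp add: norm_minus_commute)
    qed
  qed
  then show ?thesis by (simp add: sums_def_le)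
qed

lemma compact_support_moments_unique:
  fixes \<mu> \<nu> :: "real measure"
  assumes "prob_space \<mu>" "sets \<mu> = sets borel" "compact K" "AE x in \<mu>. x \<in> K"
    and "prob_space \<nu>" "sets \<nu> = sets borel" "compact L" "AE x in \<nu>. x \<in> L"
    and mom: "\<And>k. (\<integral>x. x ^ k \<partial>\<mu>) = (\<integral>x. x ^ k \<partial>\<nu>)"
  shows "\<mu> = \<nu>"
proof -
  have rd: "real_distribution \<mu>" "real_distribution \<nu>"
    using assms by (auto simp: real_distribution_def real_distribution_axioms_def)
  obtain A B where "\<forall>x\<in>K. norm x \<le> A" "\<forall>x\<in>L. norm x \<le> B"
    using assms by (meson compact_imp_bounded bounded_iff)
  then have ae: "AE x in \<mu>. \<bar>x\<bar> \<le> A" "AE x in \<nu>. \<bar>x\<bar> \<le> B"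
    using assms(4,8) by auto
  have "char \<mu> t = char \<nu> t" for t
    using char_sums_moments[OF rd(1) ae(1), of t] char_sums_moments[OF rd(2) ae(2), of t]
    unfolding mom by (rule sums_unique2)
  then show ?thesis
    using Levy_uniqueness[OF rd] by blast
qed

text \<open>This makes the definite description in \<open>dual_nanotube_eigenvalue_law\<close>
  usable: exhibiting any one law with the right moments identifies it.\<close>

lemma has_dual_nanotube_moments_unique:
  assumes "has_dual_nanotube_moments p q \<mu>" "has_dual_nanotube_moments p q \<nu>"
  shows "\<mu> = \<nu>"
proof -
  have "(\<integral>x. x ^ k \<partial>\<mu>) = (\<integral>x. x ^ k \<partial>\<nu>)" for k
    using assms unfolding has_dual_nanotube_moments_def by (metis of_real_eq_iff)
  then show ?thesis
    using assms unfolding has_dual_nanotube_moments_def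
    by (metis compact_support_moments_unique)
qed

section \<open>Closed path counts as numbers of exponents on a line\<close>

lemma prod_cis: "(\<Prod>j\<in>A. cis (f j)) = cis (\<Sum>j\<in>A. f j)"
  by (induction A rule: infinite_finite_induct) (auto simp: cis_mult)

text \<open>Write |w|^(2k) as (w * cnj w)^k and multiply out; a function h records which of the nine
  terms is chosen in each of the k factors. Every term of w * cnj w has total degree zero, so the
  exponent of z is determined by the other two. The data do not depend on x, y, z, so one expansion
  can serve both the triple integral and the random eigenvalue.\<close>

lemma cmod_exp_sum_power_expansion:
  obtains I :: "(nat \<Rightarrow> (int \<times> int) \<times> (int \<times> int)) set" and \<alpha> \<beta>
  where "finite I"
    and "\<And>x y z. complex_of_real (cmod (exp (\<i> * complex_of_real x) + exp (\<i> * complex_of_real y)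
           + exp (\<i> * complex_of_real z)) ^ (2 * k))
         = (\<Sum>h\<in>I. cis (of_int (\<alpha> h) * x + of_int (\<beta> h) * y - of_int (\<alpha> h + \<beta> h) * z))"
proof
  \<comment> \<open>The pairs (1,0), (0,1), (0,0) stand for the summands in x, y, z. The first
    component of an element of \<open>W\<close> is chosen from w, the second from its
    conjugate.\<close>
  define W :: "((int \<times> int) \<times> (int \<times> int)) set"
    where "W = {(1,0), (0,1), (0,0)} \<times> {(1,0), (0,1), (0,0)}"
  define I where "I = PiE {..<k} (\<lambda>_. W)"
  define \<alpha> where "\<alpha> h = (\<Sum>j<k. fst (fst (h j)) - fst (snd (h j)))"
    for h :: "nat \<Rightarrow> (int \<times> int) \<times> (int \<times> int)"
  define \<beta> where "\<beta> h = (\<Sum>j<k. snd (fst (h j)) - snd (snd (h j)))"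
    for h :: "nat \<Rightarrow> (int \<times> int) \<times> (int \<times> int)"
  have "finite W" by (simp add: W_def)
  then show "finite I" by (auto simp: I_def intro!: finite_PiE)
  fix x y z :: real
  let ?w = "exp (\<i> * complex_of_real x) + exp (\<i> * complex_of_real y) + exp (\<i> * complex_of_real z)"
  define f :: "(int \<times> int) \<times> (int \<times> int) \<Rightarrow> real" where
    "f e = of_int (fst (fst e) - fst (snd e)) * (x - z) + of_int (snd (fst e) - snd (snd e)) * (y - z)" for e
  have w: "?w * cnj ?w = (\<Sum>e\<in>W. cis (f e))"
    by (simp add: W_def f_def sum.cartesian_product[symmetric] cis_conv_exp[symmetric] cis_cnj
        algebra_simps cis_mult)
  have "complex_of_real (cmod ?w ^ (2 * k)) = (?w * cnj ?w) ^ k"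
    unfolding complex_norm_square[symmetric] by (simp add: power_mult)
  also have "\<dots> = (\<Prod>j<k. \<Sum>e\<in>W. cis (f e))"
    unfolding w by simp
  also have "\<dots> = (\<Sum>h\<in>I. \<Prod>j<k. cis (f (h j)))"
    unfolding I_def by (rule prod_sum_PiE) (simp_all add: \<open>finite W\<close>)
  also have "\<dots> = (\<Sum>h\<in>I. cis (of_int (\<alpha> h) * x + of_int (\<beta> h) * y - of_int (\<alpha> h + \<beta> h) * z))"
    unfolding prod_cis f_def sum.distrib sum_distrib_right[symmetric] of_int_sum[symmetric]
      \<alpha>_def[symmetric] \<beta>_def[symmetric]
    by (simp add: algebra_simps)
  finally show "complex_of_real (cmod ?w ^ (2 * k))
    = (\<Sum>h\<in>I. cis (of_int (\<alpha> h) * x + of_int (\<beta> h) * y - of_int (\<alpha> h + \<beta> h) * z))" .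
qed

lemma set_integral_cis:
  "set_integrable lborel {-pi..pi} (\<lambda>x. cis (of_int a * x))" (is ?A)
  "(LBINT x:{-pi..pi}. cis (of_int a * x)) = (if a = 0 then 2 * pi else 0)" (is ?B)
proof -
  show ?A
    by (intro borel_integrable_atLeastAtMost' continuous_intros)
  show ?B
  proof (cases "a = 0")
    case True
    then show ?thesis by (simp add: set_lebesgue_integral_def scaleR_conv_of_real)
  next
    case False
    have D: "((\<lambda>x. cis (of_int a * x) / (\<i> * of_int a)) has_vector_derivative cis (of_int a * x))
        (at x within {-pi..pi})" for x
      unfolding has_vector_derivative_def
      by (rule has_derivative_eq_rhs, (rule derivative_eq_intros refl)+)
        (use False in \<open>auto simp: field_simps scaleR_conv_of_real\<close>)
    have "(LBINT x:{-pi..pi}. cis (of_int a * x)) =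
        cis (of_int a * pi) / (\<i> * of_int a) - cis (of_int a * - pi) / (\<i> * of_int a)"
      unfolding set_lebesgue_integral_def
      by (rule integral_FTC_Icc) (auto intro!: D continuous_intros)
    also have "cis (of_int a * pi) = cis (of_int a * - pi)"
      by (simp add: complex_eq_iff)
        (metis mult.commute sin_npi_int)
    finally show ?thesis using False by simp
  qed
qed

text \<open>The coefficients \<open>c\<close> are arbitrary so that a multiple integral can be done
  one variable at a time, with the exponentials in the other variables absorbed into them.\<close>

lemma set_integral_sum_cis:
  assumes "finite I"
  shows "(LBINT x:{-pi..pi}. (\<Sum>h\<in>I. c h * cis (of_int (a h) * x)))
    = (\<Sum>h\<in>I. c h * (if a h = 0 then 2 * pi else 0))"
proof -
  have "(LBINT x:{-pi..pi}. (\<Sum>h\<in>I. c h * cis (of_int (a h) * x)))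
     = (\<Sum>h\<in>I. LBINT x:{-pi..pi}. c h * cis (of_int (a h) * x))"
    unfolding set_lebesgue_integral_def scaleR_sum_right
    using set_integrable_mult_right[OF set_integral_cis(1)]
    by (intro Bochner_Integration.integral_sum) (simp add: set_integrable_def)
  then show ?thesis by (simp add: set_integral_cis(2))
qed

lemma triple_integral_sum_cis:
  assumes "finite I"
  shows "(LBINT x:{-pi..pi}. (LBINT y:{-pi..pi}. (LBINT z:{-pi..pi}.
      (\<Sum>h\<in>I. cis (of_int (a h) * x + of_int (b h) * y + of_int (c h) * z)))))
    = (\<Sum>h\<in>I. if a h = 0 \<and> b h = 0 \<and> c h = 0 then (2 * complex_of_real pi) ^ 3 else 0)"
proof -
  define d where "d m = (if m = 0 then 2 * pi else 0)" for m :: int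
  have "(LBINT z:{-pi..pi}. (\<Sum>h\<in>I. cis (of_int (a h) * x + of_int (b h) * y + of_int (c h) * z)))
      = (\<Sum>h\<in>I. (cis (of_int (a h) * x) * d (c h)) * cis (of_int (b h) * y))" for x y
    using set_integral_sum_cis[OF assms, of "\<lambda>h. cis (of_int (a h) * x) * cis (of_int (b h) * y)" c]
    by (simp add: cis_mult[symmetric] d_def mult_ac)
  moreover have "(LBINT y:{-pi..pi}. (\<Sum>h\<in>I. (cis (of_int (a h) * x) * d (c h)) * cis (of_int (b h) * y)))
      = (\<Sum>h\<in>I. (complex_of_real (d (c h)) * d (b h)) * cis (of_int (a h) * x))" for x
    using set_integral_sum_cis[OF assms, of "\<lambda>h. cis (of_int (a h) * x) * d (c h)" b]
    by (simp add: d_def mult_ac)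
  moreover have "(LBINT x:{-pi..pi}. (\<Sum>h\<in>I. (complex_of_real (d (c h)) * d (b h)) * cis (of_int (a h) * x)))
      = (\<Sum>h\<in>I. complex_of_real (d (c h)) * d (b h) * d (a h))"
    using set_integral_sum_cis[OF assms, of "\<lambda>h. complex_of_real (d (c h)) * d (b h)" a]
    by (simp add: d_def)
  ultimately show ?thesis
    by (simp add: d_def power3_eq_cube mult_ac if_distrib cong: if_cong) (intro sum.cong; auto)
qed

lemma has_sum_finite_sum:
  fixes f :: "'i \<Rightarrow> 'a \<Rightarrow> complex"
  assumes "finite I" "\<And>h. h \<in> I \<Longrightarrow> (f h has_sum s h) A"
  shows "((\<lambda>j. \<Sum>h\<in>I. f h j) has_sum (\<Sum>h\<in>I. s h)) A"
  using assms by (induction I rule: finite_induct) (auto intro!: has_sum_add has_sum_0)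

text \<open>For each h the integral is non-zero for at most one index of the infinite sum: if the
  exponents of h are j times (p, q), only the index -j cancels them. Each h on the line thus
  contributes (2 pi)^3 exactly once, and the prefactor normalises this to 1.\<close>

lemma dual_nanotube_moment_eq_card:
  assumes n: "p + q > 0" and "finite I"
    and expansion: "\<And>x y z. complex_of_real (cmod (exp (\<i> * complex_of_real x)
           + exp (\<i> * complex_of_real y) + exp (\<i> * complex_of_real z)) ^ (2 * k))
         = (\<Sum>h\<in>I. cis (of_int (\<alpha> h) * x + of_int (\<beta> h) * y - of_int (\<alpha> h + \<beta> h) * z))"
  shows "dual_nanotube_moment p q k
    = of_nat (card {h\<in>I. \<exists>j::int. \<alpha> h = j * int p \<and> \<beta> h = j * int q})"
proof -
  define c where "c = (2 * complex_of_real pi) ^ 3"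
  define g where "g h j = (if \<alpha> h + j * int p = 0 \<and> \<beta> h + j * int q = 0 then c else 0)" for h j
  define s where "s h = (if \<exists>j::int. \<alpha> h = j * int p \<and> \<beta> h = j * int q then c else 0)" for h
  have integrand: "complex_of_real (cmod (exp (\<i> * complex_of_real x) + exp (\<i> * complex_of_real y)
          + exp (\<i> * complex_of_real z)) ^ (2 * k)) *
        exp (\<i> * of_int j * complex_of_real (real p * (x - z) + real q * (y - z)))
      = (\<Sum>h\<in>I. cis (of_int (\<alpha> h + j * int p) * x + of_int (\<beta> h + j * int q) * y
          + of_int (- (\<alpha> h + \<beta> h + j * int p + j * int q)) * z))" for x y z j
  proof -
    have "exp (\<i> * of_int j * complex_of_real (real p * (x - z) + real q * (y - z)))
      = cis (of_int j * (real p * (x - z) + real q * (y - z)))"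
      by (simp add: cis_conv_exp mult.assoc)
    then show ?thesis
      unfolding expansion sum_distrib_right
      by (simp add: cis_mult algebra_simps)
  qed
  have integral: "(LBINT x:{-pi..pi}. (LBINT y:{-pi..pi}. (LBINT z:{-pi..pi}.
         complex_of_real (cmod (exp (\<i> * complex_of_real x) + exp (\<i> * complex_of_real y)
                                + exp (\<i> * complex_of_real z)) ^ (2 * k)) *
         exp (\<i> * of_int j * complex_of_real (real p * (x - z) + real q * (y - z))))))
      = (\<Sum>h\<in>I. g h j)" for j
    \<comment> \<open>The exponent of z is minus the sum of the other two, so its vanishing is
      automatic and \<open>g\<close> tests only two conditions.\<close>
    unfolding integrand triple_integral_sum_cis[OF \<open>finite I\<close>]
    by (intro sum.cong) (auto simp: g_def c_def)
  have "(g h has_sum s h) UNIV" for h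
  proof (cases "\<exists>j::int. \<alpha> h = j * int p \<and> \<beta> h = j * int q")
    case True
    then obtain j where j: "\<alpha> h = j * int p" "\<beta> h = j * int q" by blast
    have "l = - j" if "\<alpha> h + l * int p = 0" "\<beta> h + l * int q = 0" for l
    proof -
      \<comment> \<open>Adding the two equations avoids a case split: q may be 0, but p + q is
        not.\<close>
      have "(j + l) * int (p + q) = 0" using that j by (simp add: algebra_simps)
      moreover have "int (p + q) \<noteq> 0" using n by linarith
      ultimately have "j + l = 0" by (metis mult_eq_0_iff)
      then show ?thesis by simp
    qed
    then show ?thesis
      by (intro has_sum_finite_neutralI[where B = "{- j}"]) (use j in \<open>auto simp: g_def s_def\<close>)
  next
    case False
    then have "g h j = 0" for j
      unfolding g_def by (auto dest!: spec[of _ "- j"])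
    with False show ?thesis by (auto simp: s_def intro!: has_sum_0)
  qed
  then have "((\<lambda>j. \<Sum>h\<in>I. g h j) has_sum (\<Sum>h\<in>I. s h)) UNIV"
    by (intro has_sum_finite_sum \<open>finite I\<close>)
  then have "dual_nanotube_moment p q k = complex_of_real (1 / (2 * pi) ^ 3) * (\<Sum>h\<in>I. s h)"
    unfolding dual_nanotube_moment_def integral by (simp add: infsumI)
  also have "(\<Sum>h\<in>I. s h) = c * of_nat (card {h\<in>I. \<exists>j::int. \<alpha> h = j * int p \<and> \<beta> h = j * int q})"
    unfolding s_def by (subst sum.inter_filter[OF \<open>finite I\<close>, symmetric]) simp
  finally show ?thesis by (simp add: c_def)
qed

section \<open>Averages over the discrete and the continuous variable\<close>

lemma sum_cis_roots_of_unity: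
  assumes "n > 0"
  shows "(\<Sum>m<n. cis (2 * pi * of_int a * real m / real n)) = (if int n dvd a then of_nat n else 0)"
proof -
  define w where "w = cis (2 * pi * of_int a / real n)"
  have pow: "cis (2 * pi * of_int a * real m / real n) = w ^ m" for m
    by (simp add: w_def Complex.DeMoivre mult_ac)
  have wn: "w ^ n = 1"
    using assms by (simp add: w_def Complex.DeMoivre)
  show ?thesis
  proof (cases "int n dvd a")
    case True
    then obtain b where "a = int n * b" ..
    then have "2 * pi * of_int a / real n = 2 * pi * of_int b" using assms by simp
    then have "w = 1" unfolding w_def by (simp only: cis_multiple_2pi Ints_of_int)
    with True show ?thesis by (simp add: pow)
  next
    case False
    have "w \<noteq> 1"
    proof
      assume "w = 1"
      then have "cos (2 * pi * of_int a / real n) = 1" by (simp add: w_def complex_eq_iff)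
      then obtain b :: int where "2 * pi * of_int a / real n = of_int b * 2 * pi"
        using cos_one_2pi_int by blast
      then have "of_int a = real_of_int (b * int n)" using assms by (simp add: field_simps)
      then have "a = b * int n" by linarith
      with False show False by simp
    qed
    with False wn show ?thesis by (simp add: pow sum_gp_strict)
  qed
qed

lemma set_integral_cos:
  "set_integrable lborel {0..pi} (\<lambda>u. cos (of_int a * u))" (is ?A)
  "(LBINT u:{0..pi}. cos (of_int a * u)) = (if a = 0 then pi else 0)" (is ?B)
proof -
  show ?A
    by (intro borel_integrable_atLeastAtMost' continuous_intros)
  show ?B
  proof (cases "a = 0")
    case True
    then show ?thesis by (simp add: set_lebesgue_integral_def)
  next
    case False
    have "(LBINT u:{0..pi}. cos (of_int a * u)) = sin (of_int a * pi) / of_int a - sin (of_int a * 0) / of_int a"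
      unfolding set_lebesgue_integral_def real_scaleR_def mult.commute[of "indicator _ _"]
      by (rule integral_FTC_Icc_real) (use False in \<open>auto intro!: derivative_eq_intros\<close>)
    also have "sin (of_int a * pi) = 0" using sin_npi_int[of a] by (simp add: mult.commute)
    finally show ?thesis using False by simp
  qed
qed

text \<open>Almost surely J < n, so \<open>g (U \<omega>) (J \<omega>)\<close> is the sum over m < n
  of \<open>g (U \<omega>) m\<close> times the indicator of J = m. Independence factors the
  expectation of each summand, and the bound \<open>B\<close> supplies integrability.\<close>

lemma expectation_uniform_pair:
  fixes M :: "'a measure" and U :: "'a \<Rightarrow> real" and J :: "'a \<Rightarrow> nat" and g :: "real \<Rightarrow> nat \<Rightarrow> real"
  assumes "prob_space M"
    and U[measurable]: "U \<in> borel_measurable M"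
    and J[measurable]: "J \<in> measurable M (count_space UNIV)"
    and dU: "distr M borel U = uniform_measure lborel {0<..<pi}"
    and dJ: "distr M (count_space UNIV) J = measure_pmf (pmf_of_set {0..<n})"
    and ind: "prob_space.indep_var M borel U borel (\<lambda>\<omega>. real (J \<omega>))"
    and n: "n > 0"
    and g[measurable]: "\<And>m. (\<lambda>u. g u m) \<in> borel_measurable borel"
    and bound: "\<And>u m. \<bar>g u m\<bar> \<le> B"
  shows "(\<integral>\<omega>. g (U \<omega>) (J \<omega>) \<partial>M) = (\<Sum>m<n. LBINT u:{0..pi}. g u m) / (real n * pi)"
proof -
  interpret prob_space M by fact
  have fin: "finite {0..<n}" "{0..<n} \<noteq> {}" using n by auto
  have "AE j in distr M (count_space UNIV) J. j < n"
    unfolding dJ using set_pmf_of_set[OF fin(2,1)] by (auto simp: AE_measure_pmf_iff)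
  then have Jn: "AE \<omega> in M. J \<omega> < n"
    by (subst (asm) AE_distr_iff) auto
  \<comment> \<open>Independence is assumed for \<open>real (J \<omega>)\<close>, hence the event J
    = m is expressed by a real singleton.\<close>
  have EJ: "(\<integral>\<omega>. indicator {real m} (real (J \<omega>)) \<partial>M) = 1 / real n" if "m < n" for m
  proof -
    have "(\<integral>\<omega>. indicator {real m} (real (J \<omega>)) \<partial>M) = (\<integral>\<omega>. indicat_real {m} (J \<omega>) \<partial>M)"
      by (intro Bochner_Integration.integral_cong) (auto simp: indicator_def)
    also have "\<dots> = (\<integral>j. indicator {m} j \<partial>distr M (count_space UNIV) J)"
      by (subst integral_distr) auto
    also have "\<dots> = 1 / real n"
      using that unfolding dJ by (simp add: measure_pmf_single fin)
    finally show ?thesis .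
  qed
  have EU: "(\<integral>\<omega>. g (U \<omega>) m \<partial>M) = (LBINT u:{0..pi}. g u m) / pi" for m
  proof -
    have "(\<integral>\<omega>. g (U \<omega>) m \<partial>M) = (\<integral>u. g u m \<partial>distr M borel U)"
      by (subst integral_distr) auto
    also have "\<dots> = (\<integral>u. (indicator {0<..<pi} u / pi) *\<^sub>R g u m \<partial>lborel)"
      unfolding dU uniform_measure_def
      by (subst integral_density[symmetric])
        (auto intro!: arg_cong[where f = "\<lambda>N. integral\<^sup>L N _"] density_cong
           simp: divide_ennreal[symmetric] split: split_indicator)
    \<comment> \<open>The endpoints form a null set, so the interval may be closed for the
      fundamental theorem of calculus used elsewhere.\<close>
    also have "\<dots> = (\<integral>u. (indicator {0..pi} u *\<^sub>R g u m) / pi \<partial>lborel)"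
      by (rule integral_cong_AE)
        (use AE_lborel_singleton[of "0::real"] AE_lborel_singleton[of pi] in
          \<open>auto simp: indicator_def elim!: AE_mp\<close>)
    finally show ?thesis by (simp add: set_lebesgue_integral_def)
  qed
  have int1: "integrable M (\<lambda>\<omega>. g (U \<omega>) m)" for m
    using bound by (intro integrable_const_bound[where B = B]) auto
  have int2: "integrable M (\<lambda>\<omega>. indicator {real m} (real (J \<omega>)) :: real)" for m
    by (intro integrable_const_bound[where B = 1]) auto
  have iv: "indep_var borel (\<lambda>\<omega>. g (U \<omega>) m) borel (\<lambda>\<omega>. indicator {real m} (real (J \<omega>)) :: real)" for m
    using indep_var_compose[OF ind, of "\<lambda>u. g u m" borel "indicator {real m} :: real \<Rightarrow> real" borel]
    by (simp add: o_def)
  have "(\<integral>\<omega>. g (U \<omega>) (J \<omega>) \<partial>M) = (\<integral>\<omega>. (\<Sum>m<n. g (U \<omega>) m * indicator {real m} (real (J \<omega>))) \<partial>M)"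
  proof (rule integral_cong_AE)
    show "AE \<omega> in M. g (U \<omega>) (J \<omega>) = (\<Sum>m<n. g (U \<omega>) m * indicator {real m} (real (J \<omega>)))"
      using Jn
    proof eventually_elim
      case (elim \<omega>)
      have "(\<Sum>m<n. g (U \<omega>) m * indicator {real m} (real (J \<omega>)))
          = (\<Sum>m<n. if m = J \<omega> then g (U \<omega>) m else 0)"
        by (intro sum.cong) (auto simp: indicator_def)
      with elim show ?case by simp
    qed
  qed measurable
  also have "\<dots> = (\<Sum>m<n. (\<integral>\<omega>. g (U \<omega>) m \<partial>M) * (\<integral>\<omega>. indicator {real m} (real (J \<omega>)) \<partial>M))"
    using indep_var_integrable[OF iv int1 int2] indep_var_lebesgue_integral[OF iv int1 int2]
    by (subst Bochner_Integration.integral_sum) auto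
  also have "\<dots> = (\<Sum>m<n. (LBINT u:{0..pi}. g u m) / (real n * pi))"
    by (intro sum.cong) (simp_all add: EJ EU)
  finally show ?thesis by (simp add: sum_divide_distrib)
qed

section \<open>The eigenvalue as a function on the torus\<close>

lemma cmod_exp_sum_square:
  "cmod (exp (\<i> * complex_of_real x) + exp (\<i> * complex_of_real y) + exp (\<i> * complex_of_real z)) ^ 2
    = 3 + 2 * (cos (x - y) + cos (x - z) + cos (y - z))"
proof -
  have "(cos x + cos y + cos z)\<^sup>2 + (sin x + sin y + sin z)\<^sup>2
    = ((cos x)\<^sup>2 + (sin x)\<^sup>2) + ((cos y)\<^sup>2 + (sin y)\<^sup>2) + ((cos z)\<^sup>2 + (sin z)\<^sup>2)
      + 2 * (cos (x - y) + cos (x - z) + cos (y - z))"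
    unfolding cos_diff by algebra
  then show ?thesis
    by (simp add: cis_conv_exp[symmetric] cmod_power2)
qed

definition nanotube_eigenvalue :: "nat \<Rightarrow> nat \<Rightarrow> real \<Rightarrow> nat \<Rightarrow> real" where
  "nanotube_eigenvalue p q u m = 3 + 2 * (cos u
      + cos ((real p * u + 2 * pi * real m) / real (p + q))
      + cos ((real q * u - 2 * pi * real m) / real (p + q)))"

text \<open>Only differences of x, y, z enter the squared modulus, so z can be set to 0. The other
  two phases are chosen with x - y = u: the terms in m cancel and the coefficients of u add up to (p
  + q) / (p + q). This brings the eigenvalue within reach of the same exponential expansion as the
  moments.\<close>

lemma nanotube_eigenvalue_eq_cmod:
  assumes "p + q > 0"
  shows "nanotube_eigenvalue p q u m =
    cmod (exp (\<i> * complex_of_real ((real q * u - 2 * pi * real m) / real (p + q)))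
        + exp (\<i> * complex_of_real (- ((real p * u + 2 * pi * real m) / real (p + q))))
        + exp (\<i> * complex_of_real 0)) ^ 2"
proof -
  have "real p + real q \<noteq> 0" using assms by linarith
  then have "(real q * u - 2 * pi * real m) / real (p + q) - - ((real p * u + 2 * pi * real m) / real (p + q)) = u"
    by (simp add: diff_divide_distrib add_divide_distrib)
      (simp add: mult.commute[of _ u] add_divide_distrib[symmetric] distrib_left[symmetric] add.commute)
  then show ?thesis
    unfolding cmod_exp_sum_square nanotube_eigenvalue_def by simp
qed

text \<open>The bound serves twice: for integrability of the powers and for compact support of the
  law.\<close>

lemma abs_nanotube_eigenvalue_le: "\<bar>nanotube_eigenvalue p q u m\<bar> \<le> 9"
proof -
  have "\<bar>3 + 2 * (a + b + c)\<bar> \<le> 9"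
    if "- 1 \<le> a" "a \<le> 1" "- 1 \<le> b" "b \<le> 1" "- 1 \<le> c" "c \<le> 1" for a b c :: real
    using that by (simp add: abs_if)
  then show ?thesis
    unfolding nanotube_eigenvalue_def by (simp only: cos_ge_minus_one cos_le_one)
qed

lemma borel_measurable_nanotube_eigenvalue [measurable]:
  "(\<lambda>u. nanotube_eigenvalue p q u m) \<in> borel_measurable borel"
  unfolding nanotube_eigenvalue_def by measurable

lemma continuous_on_nanotube_eigenvalue: "continuous_on A (\<lambda>u. nanotube_eigenvalue p q u m)"
  unfolding nanotube_eigenvalue_def divide_inverse by (intro continuous_intros)

text \<open>The phase of h splits into a multiple of u, called \<open>r h\<close>, and a part in m.
  Summed over m, the latter is a sum of powers of a root of unity, which leaves only those h for
  which p + q divides \<alpha> + \<beta>.\<close>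

lemma sum_nanotube_eigenvalue_power:
  assumes n: "p + q > 0" and "finite I"
    and expansion: "\<And>x y z. complex_of_real (cmod (exp (\<i> * complex_of_real x)
           + exp (\<i> * complex_of_real y) + exp (\<i> * complex_of_real z)) ^ (2 * k))
         = (\<Sum>h\<in>I. cis (of_int (\<alpha> h) * x + of_int (\<beta> h) * y - of_int (\<alpha> h + \<beta> h) * z))"
  shows "(\<Sum>m<p+q. nanotube_eigenvalue p q u m ^ k)
    = (\<Sum>h\<in>{h\<in>I. int (p + q) dvd \<alpha> h + \<beta> h}.
        real (p + q) * cos (of_int (\<alpha> h - (\<alpha> h + \<beta> h) div int (p + q) * int p) * u))"
proof -
  define n where "n = p + q"
  have n0: "real n \<noteq> 0" using n unfolding n_def by linarith
  define r where "r h = (of_int (\<alpha> h) * real q - of_int (\<beta> h) * real p) / real n * u" for h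
  have phase: "of_int (\<alpha> h) * ((real q * u - 2 * pi * real m) / real n)
        + of_int (\<beta> h) * - ((real p * u + 2 * pi * real m) / real n) - of_int (\<alpha> h + \<beta> h) * 0
      = r h + 2 * pi * of_int (- (\<alpha> h + \<beta> h)) * real m / real n" for h m
    using n0 unfolding r_def by (simp add: field_simps)
  have "complex_of_real (\<Sum>m<n. nanotube_eigenvalue p q u m ^ k)
    = (\<Sum>m<n. \<Sum>h\<in>I. cis (r h) * cis (2 * pi * of_int (- (\<alpha> h + \<beta> h)) * real m / real n))"
    unfolding of_real_sum nanotube_eigenvalue_eq_cmod[OF n] power_mult[symmetric] expansion
      n_def[symmetric] phase cis_mult ..
  also have "\<dots> = (\<Sum>h\<in>I. cis (r h) * (\<Sum>m<n. cis (2 * pi * of_int (- (\<alpha> h + \<beta> h)) * real m / real n)))"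
    by (subst sum.swap) (simp add: sum_distrib_left)
  also have "\<dots> = (\<Sum>h\<in>I. if int n dvd \<alpha> h + \<beta> h then of_nat n * cis (r h) else 0)"
    using n by (subst sum_cis_roots_of_unity) (auto simp: n_def dvd_minus_iff intro!: sum.cong simp del: minus_add_distrib)
  also have "\<dots> = (\<Sum>h\<in>{h\<in>I. int n dvd \<alpha> h + \<beta> h}. of_nat n * cis (r h))"
    by (rule sum.inter_filter[OF \<open>finite I\<close>, symmetric])
  \<comment> \<open>Taking real parts leaves cosines, which integrate to zero over $(0, \pi)$ as they are, so that
    no symmetrisation of $U$ to $(-\pi, \pi)$ is needed.\<close>
  finally have "(\<Sum>m<n. nanotube_eigenvalue p q u m ^ k)
      = Re (\<Sum>h\<in>{h\<in>I. int n dvd \<alpha> h + \<beta> h}. of_nat n * cis (r h))"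
    by (metis Re_complex_of_real)
  also have "\<dots> = (\<Sum>h\<in>{h\<in>I. int n dvd \<alpha> h + \<beta> h}. real n * cos (r h))"
    by simp
  also have "\<dots> = (\<Sum>h\<in>{h\<in>I. int n dvd \<alpha> h + \<beta> h}.
        real n * cos (of_int (\<alpha> h - (\<alpha> h + \<beta> h) div int n * int p) * u))"
  proof (rule sum.cong[OF refl])
    fix h assume "h \<in> {h\<in>I. int n dvd \<alpha> h + \<beta> h}"
    then obtain j where j: "\<alpha> h + \<beta> h = int n * j" by auto
    then have \<beta>: "real_of_int (\<beta> h) = real n * of_int j - of_int (\<alpha> h)"
      by (metis add_diff_cancel_left' of_int_diff of_int_mult of_int_of_nat_eq)
    \<comment> \<open>With \<beta> = n j - \<alpha> the numerator is \<alpha> (p + q) - n j p, a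
      multiple of n = p + q. The surviving frequencies are therefore integers.\<close>
    have "(of_int (\<alpha> h) * real q - of_int (\<beta> h) * real p) / real n = of_int (\<alpha> h - j * int p)"
      using n0 unfolding \<beta> by (simp add: field_simps n_def)
    moreover have "(\<alpha> h + \<beta> h) div int n = j" using j n0 by simp
    ultimately show "real n * cos (r h)
        = real n * cos (of_int (\<alpha> h - (\<alpha> h + \<beta> h) div int n * int p) * u)"
      by (simp add: r_def)
  qed
  finally show ?thesis unfolding n_def .
qed

text \<open>Matches the exponents that survive both averages with those counted by the moment. With
  j the quotient of a + b by p + q, vanishing frequency says a = j p, and then b = j (p + q) - j p =
  j q.\<close>

lemma line_lattice_point_iff:
  fixes a b :: int
  assumes "p + q > 0"
  shows "int (p + q) dvd a + b \<and> a - (a + b) div int (p + q) * int p = 0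
    \<longleftrightarrow> (\<exists>j. a = j * int p \<and> b = j * int q)" (is "?l \<longleftrightarrow> ?r")
proof
  assume ?l
  then obtain j where j: "a + b = int (p + q) * j" by auto
  with assms \<open>?l\<close> have "a = j * int p" by (auto simp del: of_nat_add)
  moreover from this j have "b = j * int q" by (simp add: algebra_simps)
  ultimately show ?r by blast
next
  assume ?r
  then obtain j where j: "a = j * int p" "b = j * int q" by blast
  then have "a + b = j * int (p + q)" by (simp add: algebra_simps)
  moreover have "int (p + q) \<noteq> 0" using assms by linarith
  ultimately show ?l using j by (simp del: of_nat_add)
qed

lemma sum_integral_nanotube_eigenvalue_power:
  assumes n: "p + q > 0"
  shows "complex_of_real ((\<Sum>m<p+q. LBINT u:{0..pi}. nanotube_eigenvalue p q u m ^ k) / (real (p + q) * pi))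
    = dual_nanotube_moment p q k"
proof -
  obtain I :: "(nat \<Rightarrow> (int \<times> int) \<times> (int \<times> int)) set" and \<alpha> \<beta>
    where fin: "finite I"
    and ex: "\<And>x y z. complex_of_real (cmod (exp (\<i> * complex_of_real x) + exp (\<i> * complex_of_real y)
           + exp (\<i> * complex_of_real z)) ^ (2 * k))
         = (\<Sum>h\<in>I. cis (of_int (\<alpha> h) * x + of_int (\<beta> h) * y - of_int (\<alpha> h + \<beta> h) * z))"
    using cmod_exp_sum_power_expansion[of k] by blast
  define I' where "I' = {h\<in>I. int (p + q) dvd \<alpha> h + \<beta> h}"
  define N where "N h = \<alpha> h - (\<alpha> h + \<beta> h) div int (p + q) * int p" for h
  have fin': "finite I'" using fin by (simp add: I'_def)
  \<comment> \<open>The sum over m is moved inside to be carried out first: only after it are all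
    frequencies integers, as \<open>set_integral_cos\<close> requires.\<close>
  have "(\<Sum>m<p+q. LBINT u:{0..pi}. nanotube_eigenvalue p q u m ^ k)
    = (LBINT u:{0..pi}. (\<Sum>m<p+q. nanotube_eigenvalue p q u m ^ k))"
    unfolding set_lebesgue_integral_def scaleR_sum_right
    by (rule Bochner_Integration.integral_sum[symmetric])
      (intro borel_integrable_atLeastAtMost'[unfolded set_integrable_def]
        continuous_on_power continuous_on_nanotube_eigenvalue)
  also have "\<dots> = (LBINT u:{0..pi}. (\<Sum>h\<in>I'. real (p + q) * cos (of_int (N h) * u)))"
    unfolding sum_nanotube_eigenvalue_power[OF n fin ex] I'_def N_def ..
  also have "\<dots> = (\<Sum>h\<in>I'. LBINT u:{0..pi}. real (p + q) * cos (of_int (N h) * u))"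
    unfolding set_lebesgue_integral_def scaleR_sum_right
    using set_integrable_mult_right[OF set_integral_cos(1)]
    by (intro Bochner_Integration.integral_sum) (simp add: set_integrable_def)
  also have "\<dots> = (\<Sum>h\<in>I'. if N h = 0 then real (p + q) * pi else 0)"
    by (intro sum.cong) (auto simp: set_integral_cos(2) simp del: of_nat_add)
  also have "\<dots> = (\<Sum>h\<in>{h\<in>I'. N h = 0}. real (p + q) * pi)"
    by (rule sum.inter_filter[OF fin', symmetric])
  also have "{h\<in>I'. N h = 0} = {h\<in>I. \<exists>j::int. \<alpha> h = j * int p \<and> \<beta> h = j * int q}"
    unfolding I'_def N_def using line_lattice_point_iff[OF n] by blast
  finally show ?thesis
    unfolding dual_nanotube_moment_eq_card[OF n fin ex] using n by (simp del: of_nat_add)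
qed

section \<open>Identification of the law\<close>

theorem theorem1:
  fixes p q :: nat
    and M :: "'a measure"
    and U :: "'a \<Rightarrow> real"
    and J :: "'a \<Rightarrow> nat"
  assumes "p + q \<ge> 5" and "q \<le> p"
    and "prob_space M"
    and "U \<in> borel_measurable M"
    and "J \<in> measurable M (count_space UNIV)"
    and "distr M borel U = uniform_measure lborel {0<..<pi}"
    and "distr M (count_space UNIV) J = measure_pmf (pmf_of_set {0..<p + q})"
    and "prob_space.indep_var M borel U borel (\<lambda>\<omega>. real (J \<omega>))"
  shows "dual_nanotube_eigenvalue_law p q =
    distr M borel (\<lambda>\<omega>. 3 + 2 * (cos (U \<omega>)
      + cos ((real p * U \<omega> + 2 * pi * real (J \<omega>)) / real (p + q))
      + cos ((real q * U \<omega> - 2 * pi * real (J \<omega>)) / real (p + q))))"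
proof -
  interpret prob_space M by fact
  note [measurable] = assms(4,5)
  have n: "p + q > 0" using assms(1) by linarith
  define X where "X = (\<lambda>\<omega>. nanotube_eigenvalue p q (U \<omega>) (J \<omega>))"
  have X[measurable]: "X \<in> borel_measurable M"
    unfolding X_def nanotube_eigenvalue_def by measurable
  have "complex_of_real (\<integral>x. x ^ k \<partial>distr M borel X) = dual_nanotube_moment p q k" for k
  proof -
    have "(\<integral>x. x ^ k \<partial>distr M borel X) = (\<integral>\<omega>. nanotube_eigenvalue p q (U \<omega>) (J \<omega>) ^ k \<partial>M)"
      by (subst integral_distr) (auto simp: X_def)
    also have "\<dots> = (\<Sum>m<p+q. LBINT u:{0..pi}. nanotube_eigenvalue p q u m ^ k) / (real (p + q) * pi)"
      by (rule expectation_uniform_pair[OF assms(3-8) n, where B = "9 ^ k"])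
        (auto simp: power_abs intro!: power_mono abs_nanotube_eigenvalue_le)
    finally show ?thesis
      using sum_integral_nanotube_eigenvalue_power[OF n] by simp
  qed
  moreover have "AE x in distr M borel X. x \<in> {-9..9}"
    using abs_nanotube_eigenvalue_le[of p q] by (subst AE_distr_iff) (auto simp: X_def abs_le_iff minus_le_iff)
  ultimately have "has_dual_nanotube_moments p q (distr M borel X)"
    unfolding has_dual_nanotube_moments_def using prob_space_distr[OF X]
    by (auto intro!: exI[of _ "{-9..9}"])
  \<comment> \<open>The law of \<open>X\<close> is a witness for the definite description, and
    uniqueness of the moment problem makes it the only one.\<close>
  then have "dual_nanotube_eigenvalue_law p q = distr M borel X"
    unfolding dual_nanotube_eigenvalue_law_def
    by (intro the_equality has_dual_nanotube_moments_unique)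
  then show ?thesis unfolding X_def nanotube_eigenvalue_def .
qed

end
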